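(* Let $(\mathsf V,\otimes,I)$ be a monoidal category and let $\mathsf L$ be the associated $\mathsf{Lax}^+\mathsf{Oplax}^0$-monoidal category of objects of $\mathsf V$ equipped with two commuting endomorphisms (described in the context). Then: (1) The category of cosemigroups in $\mathsf L$ (regarded as a $\mathsf{Lax}^+$-monoidal category) and the category of BiHom-comonoids in $\mathsf V$ are isomorphic. (2) The category of comonoids in the $\mathsf{Lax}^+\mathsf{Oplax}^0$-monoidal category $\mathsf L$ and the category of counital BiHom-comonoids in $\mathsf V$ are isomorphic.
   Context: Mac Lane coherence isomorphisms of $\mathsf V$ are suppressed; $gf$ means first $f$, then $g$. For $m\in\mathbb N$ put $Z(m)=1$ if $m=0$ and $Z(m)=0$ otherwise, and $\overline m=m+Z(m)$. The category $\mathsf L$: an object is a triple $(a,\alpha,\beta)$ with $a$ an object of $\mathsf V$ and $\alpha,\beta:a\to a$ with $\alpha\beta=\beta\alpha$; a morphism $(a,\alpha,\beta)\to(a',\alpha',\beta')$ is $\vartheta:a\to a'$ in $\mathsf V$ with $\vartheta\alpha=\alpha'\vartheta$, $\vartheta\beta=\beta'\vartheta$. Its product functors $\bullet_n:\mathsf L^n\to\mathsf L$ are: $\bullet_0=(I,1,1)$, $\bullet_1=$ identity functor, and for $n>1$, $\bullet_n$ is the $n$-fold product $(a_1\otimes\cdots\otimes a_n,\alpha_1\otimes\cdots\otimes\alpha_n,\beta_1\otimes\cdots\otimes\beta_n)$, acting on morphisms by $\vartheta_1\otimes\cdots\otimes\vartheta_n$. The coherence transformations are $\iota=1$ and, for $n,k_1,\dots,k_n\in\mathbb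 N$, at objects $(a_{ij},\alpha_{ij},\beta_{ij})$ ($1\le i\le n$, $1\le j\le k_i$), the endomorphisms of $\otimes_{i=1}^n\otimes_{j=1}^{k_i}a_{ij}$ $$\Phi_{k_1,\dots,k_n}=\otimes_{i}\otimes_{j}\alpha_{ij}^{\sum_{p=i+1}^n(\overline k_p-1)}\beta_{ij}^{\sum_{p=1}^{i-1}(\overline k_p-1)},\qquad \phi_{k_1,\dots,k_n}=\otimes_{i}\otimes_{j}\alpha_{ij}^{\sum_{p=i+1}^nZ(k_p)}\beta_{ij}^{\sum_{p=1}^{i-1}Z(k_p)}.$$ Here $\Phi_{k_1,\dots,k_n}$ goes from the $n$-fold product of the $k_i$-fold products, and $\phi_{k_1,\dots,k_n}$ goes from the $(\sum_ik_i)$-fold product, both to the $(\sum_i\overline k_i)$-fold product in which a unit object $\bullet_0$ is inserted in the $i$th place for each $i$ with $k_i=0$. A cosemigroup in a $\mathsf{Lax}^+$-monoidal category (category with products $\bullet_n$, $n\ge1$, and coherence transformations $\Phi_{k_1,\dots,k_n}$ for positive indices and $\iota:1\to\bullet_1$) is an object $a$ with a morphism $\delta:a\to a\bullet a$ such that $\Phi_{2,1}(\delta\bullet\iota_a)\delta=\Phi_{1,2}(\iota_a\bullet\delta)\delta$; a morphism of cosemigroups $(a,\delta)\to(a',\delta')$ is $f:a\to a'$ with $\delta'f=(f\bullet f)\delta$. A comonoid in a $\mathsf{Lax}^+\mathsf{Oplax}^0$-monoidal category with nullary product $j=\bullet_0$ is a cosemigroup $(a,\delta)$ with $\varepsilon:a\to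 j$ such that $(\varepsilon\bullet1)\delta=\phi_{0,1}\iota_a$ and $(1\bullet\varepsilon)\delta=\phi_{1,0}\iota_a$; a comonoid morphism is a cosemigroup morphism $f$ with $\varepsilon'f=\varepsilon$. A BiHom-comonoid in $\mathsf V$ is an object $a$ with $\alpha,\beta:a\to a$ and $\delta:a\to a\otimes a$ such that $\alpha\beta=\beta\alpha$, $\delta\alpha=(\alpha\otimes\alpha)\delta$, $\delta\beta=(\beta\otimes\beta)\delta$ and $(1\otimes1\otimes\beta)(\delta\otimes1)\delta=(\alpha\otimes1\otimes1)(1\otimes\delta)\delta$. It is counital if equipped with $\varepsilon:a\to I$ with $\varepsilon\alpha=\varepsilon=\varepsilon\beta$, $(\varepsilon\otimes1)\delta=\beta$, $(1\otimes\varepsilon)\delta=\alpha$. Morphisms of (counital) BiHom-comonoids are morphisms $f$ of $\mathsf V$ commuting with $\alpha$'s and $\beta$'s and satisfying $\delta'f=(f\otimes f)\delta$ (and $\varepsilon'f=\varepsilon$). *)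

theory Defs
  imports Main
begin

section \<open>Categories and isomorphism of categories\<close>

record ('o, 'm) cat =
  Obj :: "'o set"
  Arr :: "'m set"
  Dom :: "'m \<Rightarrow> 'o"
  Cod :: "'m \<Rightarrow> 'o"
  Ide :: "'o \<Rightarrow> 'm"
  Comp :: "'m \<Rightarrow> 'm \<Rightarrow> 'm"  (infixr "\<cdot>\<index>" 70)

text \<open>In \<open>g \<cdot> f\<close> the arrow \<open>f\<close> is applied first.\<close>

definition hom :: "('o, 'm, 'z) cat_scheme \<Rightarrow> 'o \<Rightarrow> 'o \<Rightarrow> 'm set" where
  "hom C a b = {f \<in> Arr C. Dom C f = a \<and> Cod C f = b}"

locale category =
  fixes C :: "('o, 'm, 'z) cat_scheme" (structure)
  assumes Dom_Obj: "f \<in> Arr C \<Longrightarrow> Dom C f \<in> Obj C"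
    and Cod_Obj: "f \<in> Arr C \<Longrightarrow> Cod C f \<in> Obj C"
    and Ide_hom: "a \<in> Obj C \<Longrightarrow> Ide C a \<in> hom C a a"
    and Comp_hom: "\<lbrakk>f \<in> hom C a b; g \<in> hom C b c\<rbrakk> \<Longrightarrow> g \<cdot> f \<in> hom C a c"
    and Comp_Ide_right: "f \<in> hom C a b \<Longrightarrow> f \<cdot> Ide C a = f"
    and Comp_Ide_left: "f \<in> hom C a b \<Longrightarrow> Ide C b \<cdot> f = f"
    and Comp_assoc: "\<lbrakk>f \<in> hom C a b; g \<in> hom C b c; h \<in> hom C c d\<rbrakk>
      \<Longrightarrow> (h \<cdot> g) \<cdot> f = h \<cdot> (g \<cdot> f)"

definition inverse_arrows :: "('o, 'm, 'z) cat_scheme \<Rightarrow> 'm \<Rightarrow> 'm \<Rightarrow> bool" where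
  "inverse_arrows C f g \<longleftrightarrow>
     f \<in> Arr C \<and> g \<in> hom C (Cod C f) (Dom C f) \<and>
     Comp C g f = Ide C (Dom C f) \<and> Comp C f g = Ide C (Cod C f)"

definition iso_arrow :: "('o, 'm, 'z) cat_scheme \<Rightarrow> 'm \<Rightarrow> bool" where
  "iso_arrow C f \<longleftrightarrow> (\<exists>g. inverse_arrows C f g)"

definition inverse_arrow :: "('o, 'm, 'z) cat_scheme \<Rightarrow> 'm \<Rightarrow> 'm" where
  "inverse_arrow C f = (THE g. inverse_arrows C f g)"

definition is_functor ::
  "('o, 'm, 'y) cat_scheme \<Rightarrow> ('p, 'n, 'z) cat_scheme \<Rightarrow> ('o \<Rightarrow> 'p) \<Rightarrow> ('m \<Rightarrow> 'n) \<Rightarrow> bool" where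
  "is_functor C D FO FA \<longleftrightarrow>
     category C \<and> category D \<and>
     (\<forall>a \<in> Obj C. FO a \<in> Obj D) \<and>
     (\<forall>a \<in> Obj C. \<forall>b \<in> Obj C. \<forall>f \<in> hom C a b. FA f \<in> hom D (FO a) (FO b)) \<and>
     (\<forall>a \<in> Obj C. FA (Ide C a) = Ide D (FO a)) \<and>
     (\<forall>f \<in> Arr C. \<forall>g \<in> Arr C. Cod C f = Dom C g \<longrightarrow> FA (Comp C g f) = Comp D (FA g) (FA f))"

definition isomorphic_categories ::
  "('o, 'm, 'y) cat_scheme \<Rightarrow> ('p, 'n, 'z) cat_scheme \<Rightarrow> bool" where
  "isomorphic_categories C D \<longleftrightarrow>
     (\<exists>FO FA GO GA.
        is_functor C D FO FA \<and> is_functor D C GO GA \<and>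
        (\<forall>a \<in> Obj C. GO (FO a) = a) \<and> (\<forall>f \<in> Arr C. GA (FA f) = f) \<and>
        (\<forall>b \<in> Obj D. FO (GO b) = b) \<and> (\<forall>g \<in> Arr D. FA (GA g) = g))"

text \<open>
  A category of objects of \<open>C\<close> with additional structure: \<open>S\<close> is the set of structured
  objects, \<open>U\<close> the underlying object, and \<open>P X f Y\<close> says that \<open>f\<close> is compatible with the
  structures of \<open>X\<close> and \<open>Y\<close>.  An arrow of \<open>C\<close> may underlie morphisms between different
  structured objects, so a morphism is recorded together with its source and target.
\<close>

definition structured_cat ::
  "('o, 'm, 'z) cat_scheme \<Rightarrow> 's set \<Rightarrow> ('s \<Rightarrow> 'o) \<Rightarrow> ('s \<Rightarrow> 'm \<Rightarrow> 's \<Rightarrow> bool)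
    \<Rightarrow> ('s, 's \<times> 'm \<times> 's) cat" where
  "structured_cat C S U P =
     \<lparr> Obj = S,
       Arr = {(X, f, Y). X \<in> S \<and> Y \<in> S \<and> f \<in> hom C (U X) (U Y) \<and> P X f Y},
       Dom = (\<lambda>(X, f, Y). X),
       Cod = (\<lambda>(X, f, Y). Y),
       Ide = (\<lambda>X. (X, Ide C (U X), X)),
       Comp = (\<lambda>(Y, g, Z) (X, f, Y'). (X, Comp C g f, Z)) \<rparr>"


section \<open>Monoidal categories\<close>

record ('o, 'm) mon = "('o, 'm) cat" +
  TenO :: "'o \<Rightarrow> 'o \<Rightarrow> 'o"  (infixr "\<otimes>\<^sub>o\<index>" 75)
  TenA :: "'m \<Rightarrow> 'm \<Rightarrow> 'm"  (infixr "\<otimes>\<^sub>a\<index>" 75)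
  UnitO :: "'o"
  Assoc :: "'o \<Rightarrow> 'o \<Rightarrow> 'o \<Rightarrow> 'm"
  LUnit :: "'o \<Rightarrow> 'm"
  RUnit :: "'o \<Rightarrow> 'm"

locale monoidal_category = category V for V :: "('o, 'm, 'z) mon_scheme" (structure) +
  assumes TenO_Obj: "\<lbrakk>a \<in> Obj V; b \<in> Obj V\<rbrakk> \<Longrightarrow> a \<otimes>\<^sub>o b \<in> Obj V"
    and TenA_hom: "\<lbrakk>f \<in> hom V a b; g \<in> hom V c d\<rbrakk> \<Longrightarrow> f \<otimes>\<^sub>a g \<in> hom V (a \<otimes>\<^sub>o c) (b \<otimes>\<^sub>o d)"
    and TenA_Ide: "\<lbrakk>a \<in> Obj V; b \<in> Obj V\<rbrakk> \<Longrightarrow> Ide V a \<otimes>\<^sub>a Ide V b = Ide V (a \<otimes>\<^sub>o b)"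
    and TenA_Comp: "\<lbrakk>f \<in> hom V a b; g \<in> hom V b c; f' \<in> hom V a' b'; g' \<in> hom V b' c'\<rbrakk>
      \<Longrightarrow> (g \<cdot> f) \<otimes>\<^sub>a (g' \<cdot> f') = (g \<otimes>\<^sub>a g') \<cdot> (f \<otimes>\<^sub>a f')"
    and UnitO_Obj: "UnitO V \<in> Obj V"
    and Assoc_hom: "\<lbrakk>a \<in> Obj V; b \<in> Obj V; c \<in> Obj V\<rbrakk>
      \<Longrightarrow> Assoc V a b c \<in> hom V ((a \<otimes>\<^sub>o b) \<otimes>\<^sub>o c) (a \<otimes>\<^sub>o (b \<otimes>\<^sub>o c))"
    and Assoc_iso: "\<lbrakk>a \<in> Obj V; b \<in> Obj V; c \<in> Obj V\<rbrakk> \<Longrightarrow> iso_arrow V (Assoc V a b c)"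
    and Assoc_natural: "\<lbrakk>f \<in> hom V a a'; g \<in> hom V b b'; h \<in> hom V c c'\<rbrakk>
      \<Longrightarrow> Assoc V a' b' c' \<cdot> ((f \<otimes>\<^sub>a g) \<otimes>\<^sub>a h) = (f \<otimes>\<^sub>a (g \<otimes>\<^sub>a h)) \<cdot> Assoc V a b c"
    and LUnit_hom: "a \<in> Obj V \<Longrightarrow> LUnit V a \<in> hom V (UnitO V \<otimes>\<^sub>o a) a"
    and LUnit_iso: "a \<in> Obj V \<Longrightarrow> iso_arrow V (LUnit V a)"
    and LUnit_natural: "f \<in> hom V a b
      \<Longrightarrow> LUnit V b \<cdot> (Ide V (UnitO V) \<otimes>\<^sub>a f) = f \<cdot> LUnit V a"
    and RUnit_hom: "a \<in> Obj V \<Longrightarrow> RUnit V a \<in> hom V (a \<otimes>\<^sub>o UnitO V) a"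
    and RUnit_iso: "a \<in> Obj V \<Longrightarrow> iso_arrow V (RUnit V a)"
    and RUnit_natural: "f \<in> hom V a b
      \<Longrightarrow> RUnit V b \<cdot> (f \<otimes>\<^sub>a Ide V (UnitO V)) = f \<cdot> RUnit V a"
    and pentagon: "\<lbrakk>a \<in> Obj V; b \<in> Obj V; c \<in> Obj V; d \<in> Obj V\<rbrakk>
      \<Longrightarrow> (Ide V a \<otimes>\<^sub>a Assoc V b c d) \<cdot> (Assoc V a (b \<otimes>\<^sub>o c) d \<cdot> (Assoc V a b c \<otimes>\<^sub>a Ide V d))
        = Assoc V a b (c \<otimes>\<^sub>o d) \<cdot> Assoc V (a \<otimes>\<^sub>o b) c d"
    and triangle: "\<lbrakk>a \<in> Obj V; b \<in> Obj V\<rbrakk>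
      \<Longrightarrow> (Ide V a \<otimes>\<^sub>a LUnit V b) \<cdot> Assoc V a (UnitO V) b = RUnit V a \<otimes>\<^sub>a Ide V b"

text \<open>Iterated tensor products are bracketed to the right.\<close>

fun tensO :: "('o, 'm, 'z) mon_scheme \<Rightarrow> 'o list \<Rightarrow> 'o" where
  "tensO V [] = UnitO V"
| "tensO V [a] = a"
| "tensO V (a # b # as) = TenO V a (tensO V (b # as))"

fun tensA :: "('o, 'm, 'z) mon_scheme \<Rightarrow> 'm list \<Rightarrow> 'm" where
  "tensA V [] = Ide V (UnitO V)"
| "tensA V [f] = f"
| "tensA V (f # g # fs) = TenA V f (tensA V (g # fs))"

text \<open>
  \<open>merge V as bs\<close> is the Mac Lane coherence isomorphism from
  \<open>tensO V as \<otimes> tensO V bs\<close> to \<open>tensO V (as @ bs)\<close>, and \<open>flatten V ass\<close> the one from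
  \<open>tensO V (map (tensO V) ass)\<close> to \<open>tensO V (concat ass)\<close>.
\<close>

fun merge :: "('o, 'm, 'z) mon_scheme \<Rightarrow> 'o list \<Rightarrow> 'o list \<Rightarrow> 'm" where
  "merge V [] bs = LUnit V (tensO V bs)"
| "merge V [a] [] = RUnit V a"
| "merge V [a] (b # bs) = Ide V (tensO V (a # b # bs))"
| "merge V (a # a' # as) bs =
     Comp V (TenA V (Ide V a) (merge V (a' # as) bs))
            (Assoc V a (tensO V (a' # as)) (tensO V bs))"

fun flatten :: "('o, 'm, 'z) mon_scheme \<Rightarrow> 'o list list \<Rightarrow> 'm" where
  "flatten V [] = Ide V (UnitO V)"
| "flatten V [as] = Ide V (tensO V as)"
| "flatten V (as # bs # bss) =
     Comp V (merge V as (concat (bs # bss)))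
            (TenA V (Ide V (tensO V as)) (flatten V (bs # bss)))"


section \<open>Cosemigroups and comonoids\<close>

text \<open>
  An object list of length \<open>n\<close> is an object of the \<open>n\<close>-th power of the category, so that
  \<open>ProdO\<close> and \<open>ProdA\<close> comprise the product functors of all arities.  A list of lists of
  objects with row lengths \<open>k\<^sub>1, \<dots>, k\<^sub>n\<close> determines the indices of the coherence
  transformations as well as the objects at which the component is taken.
  When such data are regarded as a \<open>Lax\<^sup>+\<close>-monoidal category, only non-empty lists
  (of non-empty lists) matter.
\<close>

record ('o, 'm) lax_plus = "('o, 'm) cat" +
  ProdO :: "'o list \<Rightarrow> 'o"
  ProdA :: "'m list \<Rightarrow> 'm"
  Lax :: "'o list list \<Rightarrow> 'm"  ("\<Phi>\<index>")
  Iota :: "'o \<Rightarrow> 'm"  ("\<iota>\<index>")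

record ('o, 'm) lax_plus_oplax_zero = "('o, 'm) lax_plus" +
  Oplax :: "'o list list \<Rightarrow> 'm"  ("\<phi>\<index>")

definition is_cosemigroup :: "('o, 'm, 'z) lax_plus_scheme \<Rightarrow> 'o \<times> 'm \<Rightarrow> bool" where
  "is_cosemigroup C = (\<lambda>(a, \<delta>).
     a \<in> Obj C \<and> \<delta> \<in> hom C a (ProdO C [a, a]) \<and>
     \<Phi>\<^bsub>C\<^esub> [[a, a], [a]] \<cdot>\<^bsub>C\<^esub> (ProdA C [\<delta>, \<iota>\<^bsub>C\<^esub> a] \<cdot>\<^bsub>C\<^esub> \<delta>) =
     \<Phi>\<^bsub>C\<^esub> [[a], [a, a]] \<cdot>\<^bsub>C\<^esub> (ProdA C [\<iota>\<^bsub>C\<^esub> a, \<delta>] \<cdot>\<^bsub>C\<^esub> \<delta>))"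

definition cosemigroup_cat ::
  "('o, 'm, 'z) lax_plus_scheme \<Rightarrow> ('o \<times> 'm, ('o \<times> 'm) \<times> 'm \<times> ('o \<times> 'm)) cat" where
  "cosemigroup_cat C = structured_cat C {X. is_cosemigroup C X} fst
     (\<lambda>(a, \<delta>) f (a', \<delta>'). \<delta>' \<cdot>\<^bsub>C\<^esub> f = ProdA C [f, f] \<cdot>\<^bsub>C\<^esub> \<delta>)"

definition is_comonoid ::
  "('o, 'm, 'z) lax_plus_oplax_zero_scheme \<Rightarrow> 'o \<times> 'm \<times> 'm \<Rightarrow> bool" where
  "is_comonoid C = (\<lambda>(a, \<delta>, \<epsilon>).
     is_cosemigroup C (a, \<delta>) \<and> \<epsilon> \<in> hom C a (ProdO C []) \<and>
     ProdA C [\<epsilon>, Ide C a] \<cdot>\<^bsub>C\<^esub> \<delta> = \<phi>\<^bsub>C\<^esub> [[], [a]] \<cdot>\<^bsub>C\<^esub> \<iota>\<^bsub>C\<^esub> a \<and>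
     ProdA C [Ide C a, \<epsilon>] \<cdot>\<^bsub>C\<^esub> \<delta> = \<phi>\<^bsub>C\<^esub> [[a], []] \<cdot>\<^bsub>C\<^esub> \<iota>\<^bsub>C\<^esub> a)"

definition comonoid_cat ::
  "('o, 'm, 'z) lax_plus_oplax_zero_scheme
    \<Rightarrow> ('o \<times> 'm \<times> 'm, ('o \<times> 'm \<times> 'm) \<times> 'm \<times> ('o \<times> 'm \<times> 'm)) cat" where
  "comonoid_cat C = structured_cat C {X. is_comonoid C X} fst
     (\<lambda>(a, \<delta>, \<epsilon>) f (a', \<delta>', \<epsilon>').
        \<delta>' \<cdot>\<^bsub>C\<^esub> f = ProdA C [f, f] \<cdot>\<^bsub>C\<^esub> \<delta> \<and> \<epsilon>' \<cdot>\<^bsub>C\<^esub> f = \<epsilon>)"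


section \<open>Objects with two commuting endomorphisms\<close>

type_synonym ('o, 'm) lobj = "'o \<times> 'm \<times> 'm"
type_synonym ('o, 'm) larr = "('o, 'm) lobj \<times> 'm \<times> ('o, 'm) lobj"

definition L_cat :: "('o, 'm, 'z) mon_scheme \<Rightarrow> (('o, 'm) lobj, ('o, 'm) larr) cat" where
  "L_cat V = structured_cat V
     {(a, \<alpha>, \<beta>). a \<in> Obj V \<and> \<alpha> \<in> hom V a a \<and> \<beta> \<in> hom V a a \<and> \<alpha> \<cdot>\<^bsub>V\<^esub> \<beta> = \<beta> \<cdot>\<^bsub>V\<^esub> \<alpha>}
     fst
     (\<lambda>(a, \<alpha>, \<beta>) \<theta> (a', \<alpha>', \<beta>'). \<theta> \<cdot>\<^bsub>V\<^esub> \<alpha> = \<alpha>' \<cdot>\<^bsub>V\<^esub> \<theta> \<and> \<theta> \<cdot>\<^bsub>V\<^esub> \<beta> = \<beta>' \<cdot>\<^bsub>V\<^esub> \<theta>)"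

definition L_prodO :: "('o, 'm, 'z) mon_scheme \<Rightarrow> ('o, 'm) lobj list \<Rightarrow> ('o, 'm) lobj" where
  "L_prodO V Xs =
     (tensO V (map (\<lambda>(a, \<alpha>, \<beta>). a) Xs),
      tensA V (map (\<lambda>(a, \<alpha>, \<beta>). \<alpha>) Xs),
      tensA V (map (\<lambda>(a, \<alpha>, \<beta>). \<beta>) Xs))"

definition L_prodA :: "('o, 'm, 'z) mon_scheme \<Rightarrow> ('o, 'm) larr list \<Rightarrow> ('o, 'm) larr" where
  "L_prodA V Fs =
     (L_prodO V (map (\<lambda>(X, \<theta>, Y). X) Fs),
      tensA V (map (\<lambda>(X, \<theta>, Y). \<theta>) Fs),
      L_prodO V (map (\<lambda>(X, \<theta>, Y). Y) Fs))"

definition Z :: "nat \<Rightarrow> nat" where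
  "Z m = (if m = 0 then 1 else 0)"

definition bar :: "nat \<Rightarrow> nat" where
  "bar m = m + Z m"

definition arr_pow :: "('o, 'm, 'z) cat_scheme \<Rightarrow> 'o \<Rightarrow> 'm \<Rightarrow> nat \<Rightarrow> 'm" where
  "arr_pow C a f n = (Comp C f ^^ n) (Ide C a)"

text \<open>
  The endomorphism of the nested tensor product, with factors
  \<open>\<alpha>\<^sub>i\<^sub>j\<close> to the power \<open>\<Sum>p>i. w k\<^sub>p\<close> times \<open>\<beta>\<^sub>i\<^sub>j\<close> to the power \<open>\<Sum>p<i. w k\<^sub>p\<close>,
  where \<open>k\<^sub>p\<close> is the length of the \<open>p\<close>-th row; \<open>i\<close> and \<open>p\<close> are counted from \<open>0\<close>.
  The weight \<open>w\<close> is \<open>k \<mapsto> bar k - 1\<close> for \<open>\<Phi>\<close> and \<open>Z\<close> for \<open>\<phi>\<close>.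
\<close>

definition L_endo ::
  "('o, 'm, 'z) mon_scheme \<Rightarrow> (nat \<Rightarrow> nat) \<Rightarrow> ('o, 'm) lobj list list \<Rightarrow> 'm" where
  "L_endo V w Xss = tensA V (map (\<lambda>i.
     tensA V (map (\<lambda>(a, \<alpha>, \<beta>).
         arr_pow V a \<alpha> (\<Sum>p = i + 1..<length Xss. w (length (Xss ! p)))
         \<cdot>\<^bsub>V\<^esub> arr_pow V a \<beta> (\<Sum>p = 0..<i. w (length (Xss ! p))))
       (Xss ! i))) [0..<length Xss])"

text \<open>Insertion of the nullary product at the position of each empty row.\<close>

definition L_plug ::
  "('o, 'm, 'z) mon_scheme \<Rightarrow> ('o, 'm) lobj list list \<Rightarrow> ('o, 'm) lobj list list" where
  "L_plug V Xss = map (\<lambda>Xs. if Xs = [] then [L_prodO V []] else Xs) Xss"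

text \<open>
  \<open>V\<close> is not assumed to be strict, so the endomorphisms defining \<open>\<Phi>\<close> and \<open>\<phi>\<close> are composed
  with coherence isomorphisms.  Since an empty row and a row consisting of the unit object
  have the same tensor product, \<open>flatten\<close> at the plugged rows also starts at the nested
  product of the original rows.
\<close>

definition L_Phi ::
  "('o, 'm, 'z) mon_scheme \<Rightarrow> ('o, 'm) lobj list list \<Rightarrow> ('o, 'm) larr" where
  "L_Phi V Xss =
     (L_prodO V (map (L_prodO V) Xss),
      flatten V (map (map fst) (L_plug V Xss)) \<cdot>\<^bsub>V\<^esub> L_endo V (\<lambda>k. bar k - 1) Xss,
      L_prodO V (concat (L_plug V Xss)))"

definition L_phi ::
  "('o, 'm, 'z) mon_scheme \<Rightarrow> ('o, 'm) lobj list list \<Rightarrow> ('o, 'm) larr" where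
  "L_phi V Xss =
     (L_prodO V (concat Xss),
      flatten V (map (map fst) (L_plug V Xss)) \<cdot>\<^bsub>V\<^esub>
        (L_endo V Z Xss \<cdot>\<^bsub>V\<^esub> inverse_arrow V (flatten V (map (map fst) Xss))),
      L_prodO V (concat (L_plug V Xss)))"

definition L_monoidal ::
  "('o, 'm, 'z) mon_scheme \<Rightarrow> (('o, 'm) lobj, ('o, 'm) larr) lax_plus_oplax_zero" where
  "L_monoidal V =
     \<lparr> Obj = Obj (L_cat V), Arr = Arr (L_cat V), Dom = Dom (L_cat V), Cod = Cod (L_cat V),
       Ide = Ide (L_cat V), Comp = Comp (L_cat V),
       ProdO = L_prodO V, ProdA = L_prodA V,
       Lax = L_Phi V, Iota = Ide (L_cat V), Oplax = L_phi V \<rparr>"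


section \<open>BiHom-comonoids\<close>

text \<open>
  The two sides of BiHom-coassociativity take values in the two bracketings of the threefold
  tensor product, which are compared by the associator; similarly for the counit laws and
  the unitors.
\<close>

definition is_bihom_comonoid ::
  "('o, 'm, 'z) mon_scheme \<Rightarrow> 'o \<times> 'm \<times> 'm \<times> 'm \<Rightarrow> bool" where
  "is_bihom_comonoid V = (\<lambda>(a, \<alpha>, \<beta>, \<delta>).
     a \<in> Obj V \<and> \<alpha> \<in> hom V a a \<and> \<beta> \<in> hom V a a \<and> \<delta> \<in> hom V a (a \<otimes>\<^sub>o\<^bsub>V\<^esub> a) \<and>
     \<alpha> \<cdot>\<^bsub>V\<^esub> \<beta> = \<beta> \<cdot>\<^bsub>V\<^esub> \<alpha> \<and>
     \<delta> \<cdot>\<^bsub>V\<^esub> \<alpha> = (\<alpha> \<otimes>\<^sub>a\<^bsub>V\<^esub> \<alpha>) \<cdot>\<^bsub>V\<^esub> \<delta> \<and>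
     \<delta> \<cdot>\<^bsub>V\<^esub> \<beta> = (\<beta> \<otimes>\<^sub>a\<^bsub>V\<^esub> \<beta>) \<cdot>\<^bsub>V\<^esub> \<delta> \<and>
     Assoc V a a a \<cdot>\<^bsub>V\<^esub>
       (((Ide V a \<otimes>\<^sub>a\<^bsub>V\<^esub> Ide V a) \<otimes>\<^sub>a\<^bsub>V\<^esub> \<beta>) \<cdot>\<^bsub>V\<^esub> ((\<delta> \<otimes>\<^sub>a\<^bsub>V\<^esub> Ide V a) \<cdot>\<^bsub>V\<^esub> \<delta>)) =
     (\<alpha> \<otimes>\<^sub>a\<^bsub>V\<^esub> (Ide V a \<otimes>\<^sub>a\<^bsub>V\<^esub> Ide V a)) \<cdot>\<^bsub>V\<^esub> ((Ide V a \<otimes>\<^sub>a\<^bsub>V\<^esub> \<delta>) \<cdot>\<^bsub>V\<^esub> \<delta>))"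

definition bihom_comonoid_cat ::
  "('o, 'm, 'z) mon_scheme \<Rightarrow>
    ('o \<times> 'm \<times> 'm \<times> 'm, ('o \<times> 'm \<times> 'm \<times> 'm) \<times> 'm \<times> ('o \<times> 'm \<times> 'm \<times> 'm)) cat" where
  "bihom_comonoid_cat V = structured_cat V {X. is_bihom_comonoid V X} fst
     (\<lambda>(a, \<alpha>, \<beta>, \<delta>) f (a', \<alpha>', \<beta>', \<delta>').
        f \<cdot>\<^bsub>V\<^esub> \<alpha> = \<alpha>' \<cdot>\<^bsub>V\<^esub> f \<and> f \<cdot>\<^bsub>V\<^esub> \<beta> = \<beta>' \<cdot>\<^bsub>V\<^esub> f \<and> \<delta>' \<cdot>\<^bsub>V\<^esub> f = (f \<otimes>\<^sub>a\<^bsub>V\<^esub> f) \<cdot>\<^bsub>V\<^esub> \<delta>)"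

definition is_counital_bihom_comonoid ::
  "('o, 'm, 'z) mon_scheme \<Rightarrow> 'o \<times> 'm \<times> 'm \<times> 'm \<times> 'm \<Rightarrow> bool" where
  "is_counital_bihom_comonoid V = (\<lambda>(a, \<alpha>, \<beta>, \<delta>, \<epsilon>).
     is_bihom_comonoid V (a, \<alpha>, \<beta>, \<delta>) \<and>
     \<epsilon> \<in> hom V a (UnitO V) \<and> \<epsilon> \<cdot>\<^bsub>V\<^esub> \<alpha> = \<epsilon> \<and> \<epsilon> \<cdot>\<^bsub>V\<^esub> \<beta> = \<epsilon> \<and>
     LUnit V a \<cdot>\<^bsub>V\<^esub> ((\<epsilon> \<otimes>\<^sub>a\<^bsub>V\<^esub> Ide V a) \<cdot>\<^bsub>V\<^esub> \<delta>) = \<beta> \<and>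
     RUnit V a \<cdot>\<^bsub>V\<^esub> ((Ide V a \<otimes>\<^sub>a\<^bsub>V\<^esub> \<epsilon>) \<cdot>\<^bsub>V\<^esub> \<delta>) = \<alpha>)"

definition counital_bihom_comonoid_cat ::
  "('o, 'm, 'z) mon_scheme \<Rightarrow>
    ('o \<times> 'm \<times> 'm \<times> 'm \<times> 'm,
     ('o \<times> 'm \<times> 'm \<times> 'm \<times> 'm) \<times> 'm \<times> ('o \<times> 'm \<times> 'm \<times> 'm \<times> 'm)) cat" where
  "counital_bihom_comonoid_cat V = structured_cat V {X. is_counital_bihom_comonoid V X} fst
     (\<lambda>(a, \<alpha>, \<beta>, \<delta>, \<epsilon>) f (a', \<alpha>', \<beta>', \<delta>', \<epsilon>').
        f \<cdot>\<^bsub>V\<^esub> \<alpha> = \<alpha>' \<cdot>\<^bsub>V\<^esub> f \<and> f \<cdot>\<^bsub>V\<^esub> \<beta> = \<beta>' \<cdot>\<^bsub>V\<^esub> f \<and>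
        \<delta>' \<cdot>\<^bsub>V\<^esub> f = (f \<otimes>\<^sub>a\<^bsub>V\<^esub> f) \<cdot>\<^bsub>V\<^esub> \<delta> \<and> \<epsilon>' \<cdot>\<^bsub>V\<^esub> f = \<epsilon>)"

end

theory Submission
  imports Defs
begin

text \<open>
  A cosemigroup in \<open>L\<close> consists of an object \<open>(a, \<alpha>, \<beta>)\<close> and an arrow \<open>\<delta>\<close> of \<open>L\<close> from it to
  \<open>(a \<otimes> a, \<alpha> \<otimes> \<alpha>, \<beta> \<otimes> \<beta>)\<close>.  That \<open>\<delta>\<close> is an arrow of \<open>L\<close> means precisely that it is
  compatible with \<open>\<alpha>\<close> and \<open>\<beta>\<close>.  Up to Mac Lane coherence, \<open>\<Phi>\<close> at the indices \<open>2, 1\<close> is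
  \<open>1 \<otimes> 1 \<otimes> \<beta>\<close> and at \<open>1, 2\<close> it is \<open>\<alpha> \<otimes> 1 \<otimes> 1\<close> (\<open>L_Phi_two_one\<close>, \<open>L_Phi_one_two\<close>), so that
  coassociativity in \<open>L\<close> is BiHom-coassociativity in \<open>V\<close>
  (\<open>is_cosemigroup_L_monoidal_iff\<close>).  A counit in \<open>L\<close> is an arrow to \<open>(I, 1, 1)\<close>, hence satisfies
  \<open>\<epsilon>\<alpha> = \<epsilon> = \<epsilon>\<beta>\<close>; as \<open>\<phi>\<close> at the indices \<open>0, 1\<close> and \<open>1, 0\<close> is \<open>\<beta>\<close> and \<open>\<alpha>\<close>, respectively, followed
  by the inverse of a unitor (\<open>L_phi_zero_one\<close>, \<open>L_phi_one_zero\<close>), the counit laws also agree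
  (\<open>is_comonoid_L_monoidal_iff\<close>).

  Thus both kinds of structured object are the same data, differently bundled.  An arrow of \<open>L\<close>
  is an arrow \<open>\<theta>\<close> of \<open>V\<close> commuting with \<open>\<alpha>\<close> and \<open>\<beta>\<close>, and passing to \<open>\<theta>\<close> identifies the
  morphisms as well.  That such a rebundling gives an isomorphism of categories is
  proved once and for all in \<open>isomorphic_structured_cats\<close>.
\<close>

section \<open>Categories of structured objects\<close>

lemma homD:
  assumes "f \<in> hom C a b"
  shows "f \<in> Arr C" "Dom C f = a" "Cod C f = b"
  using assms by (auto simp: hom_def)

lemma structured_cat_simps [simp]:
  "Obj (structured_cat C S U P) = S"
  "(X, f, Y) \<in> Arr (structured_cat C S U P) \<longleftrightarrow>
     X \<in> S \<and> Y \<in> S \<and> f \<in> hom C (U X) (U Y) \<and> P X f Y"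
  "Dom (structured_cat C S U P) (X, f, Y) = X"
  "Cod (structured_cat C S U P) (X, f, Y) = Y"
  "Ide (structured_cat C S U P) X = (X, Ide C (U X), X)"
  "Comp (structured_cat C S U P) (Y', g, X') (X, f, Y) = (X, Comp C g f, X')"
  by (auto simp: structured_cat_def)

lemma hom_structured_cat:
  "F \<in> hom (structured_cat C S U P) X Y \<longleftrightarrow>
     X \<in> S \<and> Y \<in> S \<and> (\<exists>f. F = (X, f, Y) \<and> f \<in> hom C (U X) (U Y) \<and> P X f Y)"
  by (cases F) (auto simp: hom_def[of "structured_cat C S U P"])

lemma category_structured_cat:
  assumes "category C"
    and U: "\<And>X. X \<in> S \<Longrightarrow> U X \<in> Obj C"
    and P_Ide: "\<And>X. X \<in> S \<Longrightarrow> P X (Ide C (U X)) X"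
    and P_Comp: "\<And>X Y Z f g. \<lbrakk>X \<in> S; Y \<in> S; Z \<in> S; f \<in> hom C (U X) (U Y); g \<in> hom C (U Y) (U Z);
      P X f Y; P Y g Z\<rbrakk> \<Longrightarrow> P X (Comp C g f) Z"
  shows "category (structured_cat C S U P)"
proof -
  interpret category C by fact
  show ?thesis
  proof
    show "Dom (structured_cat C S U P) f \<in> Obj (structured_cat C S U P)"
      if "f \<in> Arr (structured_cat C S U P)" for f
      using that by (cases f) auto
    show "Cod (structured_cat C S U P) f \<in> Obj (structured_cat C S U P)"
      if "f \<in> Arr (structured_cat C S U P)" for f
      using that by (cases f) auto
  qed (auto simp: hom_structured_cat intro: U P_Ide P_Comp Ide_hom Comp_hom
      Comp_Ide_right Comp_Ide_left Comp_assoc)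
qed

lemma category_structured_catD:
  assumes "category (structured_cat D T W Q)"
  shows "X \<in> T \<Longrightarrow> Q X (Ide D (W X)) X"
    and "\<lbrakk>X \<in> T; Y \<in> T; X' \<in> T; f \<in> hom D (W X) (W Y); g \<in> hom D (W Y) (W X'); Q X f Y; Q Y g X'\<rbrakk>
      \<Longrightarrow> Q X (Comp D g f) X'"
proof -
  interpret category "structured_cat D T W Q" by fact
  show "Q X (Ide D (W X)) X" if "X \<in> T"
    using Ide_hom[of X] that by (auto simp: hom_structured_cat)
  show "Q X (Comp D g f) X'"
    if "X \<in> T" "Y \<in> T" "X' \<in> T" "f \<in> hom D (W X) (W Y)" "g \<in> hom D (W Y) (W X')" "Q X f Y" "Q Y g X'"
    using Comp_hom[of "(X, f, Y)" X Y "(Y, g, X')" X'] that by (auto simp: hom_structured_cat)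
qed

text \<open>
  A functor that is bijective on objects and on arrows is an isomorphism: functoriality of the
  inverse is automatic.
\<close>

lemma isomorphic_categoriesI:
  assumes F: "is_functor C D FO FA"
    and O: "bij_betw FO (Obj C) (Obj D)"
    and A: "bij_betw FA (Arr C) (Arr D)"
  shows "isomorphic_categories C D"
proof -
  from F interpret C: category C by (simp add: is_functor_def)
  from F interpret D: category D by (simp add: is_functor_def)
  define GO where "GO = inv_into (Obj C) FO"
  define GA where "GA = inv_into (Arr C) FA"
  have GO: "GO b \<in> Obj C" "FO (GO b) = b" if "b \<in> Obj D" for b
    using that O unfolding GO_def bij_betw_def by (auto intro: inv_into_into f_inv_into_f)
  have GA: "GA g \<in> Arr C" "FA (GA g) = g" if "g \<in> Arr D" for g
    using that A unfolding GA_def bij_betw_def by (auto intro: inv_into_into f_inv_into_f)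
  have GO': "GO (FO a) = a" if "a \<in> Obj C" for a
    using that O unfolding GO_def bij_betw_def by simp
  have GA': "GA (FA f) = f" if "f \<in> Arr C" for f
    using that A unfolding GA_def bij_betw_def by simp
  have FO_Obj: "FO a \<in> Obj D" if "a \<in> Obj C" for a
    using F that by (simp add: is_functor_def)
  have F_hom: "FA f \<in> hom D (FO (Dom C f)) (FO (Cod C f))" if "f \<in> Arr C" for f
    using F that C.Dom_Obj[OF that] C.Cod_Obj[OF that] by (simp add: is_functor_def hom_def)
  have GA_hom: "GA g \<in> hom C (GO (Dom D g)) (GO (Cod D g))" if "g \<in> Arr D" for g
    using F_hom[OF GA(1)[OF that]] GA[OF that] GO' C.Dom_Obj C.Cod_Obj
    by (auto simp: hom_def)
  have "is_functor D C GO GA"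
    unfolding is_functor_def
  proof (intro conjI ballI impI)
    show "GA f \<in> hom C (GO a) (GO b)" if "f \<in> hom D a b" for a b f
      using GA_hom[of f] homD[OF that] by simp
    show "GA (Ide D b) = Ide C (GO b)" if b: "b \<in> Obj D" for b
    proof -
      have "FA (Ide C (GO b)) = Ide D b"
        using F GO[OF b] by (simp add: is_functor_def)
      then show ?thesis
        using GA' homD(1)[OF C.Ide_hom[OF GO(1)[OF b]]] by metis
    qed
    show "GA (Comp D g f) = Comp C (GA g) (GA f)"
      if f: "f \<in> Arr D" and g: "g \<in> Arr D" and fg: "Cod D f = Dom D g" for f g
    proof -
      have h: "GA f \<in> hom C (GO (Dom D f)) (GO (Dom D g))" "GA g \<in> hom C (GO (Dom D g)) (GO (Cod D g))"
        using GA_hom f g fg by metis+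
      then have "FA (Comp C (GA g) (GA f)) = Comp D g f"
        using F GA[OF f] GA[OF g] homD[OF h(1)] homD[OF h(2)] by (simp add: is_functor_def)
      then show ?thesis
        using GA' homD(1)[OF C.Comp_hom[OF h]] by metis
    qed
  qed (use GO C.category_axioms D.category_axioms in auto)
  with F GO GO' GA GA' show ?thesis
    unfolding isomorphic_categories_def by blast
qed

text \<open>
  The base categories may differ: \<open>F\<close> translates structured objects and \<open>A\<close> the underlying
  arrows.  Only the second category of structured objects is assumed to be a category; that
  the compatible arrows of the first one are closed under composition is then a consequence.
\<close>

lemma isomorphic_structured_cats:
  assumes C: "category C"
    and D: "category (structured_cat D T W Q)"
    and U: "\<And>X. X \<in> S \<Longrightarrow> U X \<in> Obj C"
    and F: "bij_betw F S T"
    and A_Ide: "\<And>X. X \<in> S \<Longrightarrow> A (Ide C (U X)) = Ide D (W (F X))"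
    and A_Comp: "\<And>X Y Z f g. \<lbrakk>X \<in> S; Y \<in> S; Z \<in> S; f \<in> hom C (U X) (U Y); g \<in> hom C (U Y) (U Z)\<rbrakk>
      \<Longrightarrow> A (Comp C g f) = Comp D (A g) (A f)"
    and A_hom: "\<And>X Y f. \<lbrakk>X \<in> S; Y \<in> S; f \<in> hom C (U X) (U Y)\<rbrakk>
      \<Longrightarrow> A f \<in> hom D (W (F X)) (W (F Y))"
    and P_iff_Q: "\<And>X Y f. \<lbrakk>X \<in> S; Y \<in> S; f \<in> hom C (U X) (U Y)\<rbrakk>
      \<Longrightarrow> P X f Y \<longleftrightarrow> Q (F X) (A f) (F Y)"
    and A_inj: "\<And>X Y. \<lbrakk>X \<in> S; Y \<in> S\<rbrakk> \<Longrightarrow> inj_on A (hom C (U X) (U Y))"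
    and A_surj: "\<And>X Y g. \<lbrakk>X \<in> S; Y \<in> S; g \<in> hom D (W (F X)) (W (F Y)); Q (F X) g (F Y)\<rbrakk>
      \<Longrightarrow> g \<in> A ` hom C (U X) (U Y)"
  shows "isomorphic_categories (structured_cat C S U P) (structured_cat D T W Q)"
proof (rule isomorphic_categoriesI)
  interpret C: category C by fact
  let ?A = "\<lambda>(X, f, Y). (F X, A f, F Y)"
  have FT: "F X \<in> T" if "X \<in> S" for X
    using F that by (auto simp: bij_betw_def)
  have Q_Comp: "Q (F X) (Comp D (A g) (A f)) (F Z)"
    if "X \<in> S" "Y \<in> S" "Z \<in> S" "f \<in> hom C (U X) (U Y)" "g \<in> hom C (U Y) (U Z)"
      "Q (F X) (A f) (F Y)" "Q (F Y) (A g) (F Z)" for X Y Z f g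
    using category_structured_catD(2)[OF D] FT A_hom that by meson
  have "category (structured_cat C S U P)"
  proof (rule category_structured_cat[OF C U])
    show "P X (Ide C (U X)) X" if "X \<in> S" for X
      using category_structured_catD(1)[OF D] that
      by (subst P_iff_Q) (auto intro: C.Ide_hom U simp: FT A_Ide)
    show "P X (Comp C g f) Z"
      if *: "X \<in> S" "Y \<in> S" "Z \<in> S" "f \<in> hom C (U X) (U Y)" "g \<in> hom C (U Y) (U Z)"
        "P X f Y" "P Y g Z" for X Y Z f g
      using Q_Comp[OF *(1-5)] * C.Comp_hom[OF *(4,5)] by (simp add: P_iff_Q A_Comp[OF *(1-5)])
  qed
  then show "is_functor (structured_cat C S U P) (structured_cat D T W Q) F ?A"
    using D by (auto simp: is_functor_def hom_structured_cat FT A_hom P_iff_Q A_Ide A_Comp)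
  show "bij_betw F (Obj (structured_cat C S U P)) (Obj (structured_cat D T W Q))"
    using F by simp
  show "bij_betw ?A (Arr (structured_cat C S U P)) (Arr (structured_cat D T W Q))"
    unfolding bij_betw_def
  proof
    show "inj_on ?A (Arr (structured_cat C S U P))"
    proof (rule inj_onI)
      fix u v assume uv: "u \<in> Arr (structured_cat C S U P)" "v \<in> Arr (structured_cat C S U P)"
        "?A u = ?A v"
      obtain X f Y X' f' Y' where u: "u = (X, f, Y)" and v: "v = (X', f', Y')"
        by (metis prod_cases3)
      then have "X = X'" "Y = Y'"
        using uv F by (auto simp: bij_betw_def dest: inj_onD)
      then show "u = v"
        using uv A_inj[of X Y] by (auto simp: u v dest: inj_onD)
    qed
    have "(X', g, Y') \<in> ?A ` Arr (structured_cat C S U P)"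
      if g: "(X', g, Y') \<in> Arr (structured_cat D T W Q)" for X' g Y'
    proof -
      obtain X Y where XY: "X \<in> S" "Y \<in> S" "X' = F X" "Y' = F Y"
        using F g by (auto simp: bij_betw_def)
      then obtain f where f: "f \<in> hom C (U X) (U Y)" "g = A f"
        using A_surj[of X Y g] g by auto
      then have "(X, f, Y) \<in> Arr (structured_cat C S U P)"
        using XY g P_iff_Q by simp
      then show ?thesis
        using XY f by (intro image_eqI[of _ _ "(X, f, Y)"]) auto
    qed
    then show "?A ` Arr (structured_cat C S U P) = Arr (structured_cat D T W Q)"
      by (auto simp: FT A_hom P_iff_Q)
  qed
qed


section \<open>Objects with two commuting endomorphisms\<close>

lemma L_monoidal_simps [simp]:
  "Obj (L_monoidal V) = Obj (L_cat V)"
  "Ide (L_monoidal V) X = (X, Ide V (fst X), X)"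
  "Comp (L_monoidal V) (Y', g, X') (X, f, Y) = (X, Comp V g f, X')"
  "ProdO (L_monoidal V) = L_prodO V"
  "ProdA (L_monoidal V) = L_prodA V"
  "Lax (L_monoidal V) = L_Phi V"
  "Iota (L_monoidal V) X = (X, Ide V (fst X), X)"
  "Oplax (L_monoidal V) = L_phi V"
  by (simp_all add: L_monoidal_def L_cat_def)

lemma hom_L_monoidal: "hom (L_monoidal V) = hom (L_cat V)"
  by (simp add: hom_def L_monoidal_def fun_eq_iff)

lemma Obj_L_cat:
  "(a, \<alpha>, \<beta>) \<in> Obj (L_cat V) \<longleftrightarrow>
     a \<in> Obj V \<and> \<alpha> \<in> hom V a a \<and> \<beta> \<in> hom V a a \<and> Comp V \<alpha> \<beta> = Comp V \<beta> \<alpha>"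
  by (simp add: L_cat_def)

lemma hom_L_cat:
  "F \<in> hom (L_cat V) (a, \<alpha>, \<beta>) (a', \<alpha>', \<beta>') \<longleftrightarrow>
     (a, \<alpha>, \<beta>) \<in> Obj (L_cat V) \<and> (a', \<alpha>', \<beta>') \<in> Obj (L_cat V) \<and>
     (\<exists>\<theta>. F = ((a, \<alpha>, \<beta>), \<theta>, (a', \<alpha>', \<beta>')) \<and> \<theta> \<in> hom V a a' \<and>
       Comp V \<theta> \<alpha> = Comp V \<alpha>' \<theta> \<and> Comp V \<theta> \<beta> = Comp V \<beta>' \<theta>)"
  unfolding L_cat_def hom_structured_cat by simp

context category
begin

lemma inverse_arrows_inverse_arrow:
  assumes "iso_arrow C u"
  shows "inverse_arrows C u (inverse_arrow C u)"
proof -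
  obtain v where v: "inverse_arrows C u v"
    using assms by (auto simp: iso_arrow_def)
  have "w = v" if w: "inverse_arrows C u w" for w
  proof -
    have u: "u \<in> hom C (Dom C u) (Cod C u)"
      using v by (simp add: inverse_arrows_def hom_def)
    have vh: "v \<in> hom C (Cod C u) (Dom C u)" and wh: "w \<in> hom C (Cod C u) (Dom C u)"
      using v w by (simp_all add: inverse_arrows_def)
    have "w = w \<cdot> (u \<cdot> v)"
      using v Comp_Ide_right[OF wh] by (simp add: inverse_arrows_def)
    also have "\<dots> = (w \<cdot> u) \<cdot> v"
      using Comp_assoc[OF vh u wh] by simp
    also have "\<dots> = v"
      using w Comp_Ide_left[OF vh] by (simp add: inverse_arrows_def)
    finally show ?thesis .
  qed
  with v show ?thesis
    unfolding inverse_arrow_def by (metis theI)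
qed

lemma inverse_arrow_hom:
  assumes "iso_arrow C u" "u \<in> hom C b c"
  shows "inverse_arrow C u \<in> hom C c b"
  using inverse_arrows_inverse_arrow[OF assms(1)] homD[OF assms(2)]
  by (simp add: inverse_arrows_def)

text \<open>
  With a unitor for \<open>u\<close>, this translates between the counit laws of a comonoid in \<open>L\<close> and those of
  a BiHom-comonoid.
\<close>

lemma eq_inverse_arrow_Comp_iff:
  assumes u: "iso_arrow C u" "u \<in> hom C b c" and f: "f \<in> hom C a b" and g: "g \<in> hom C a c"
  shows "f = inverse_arrow C u \<cdot> g \<longleftrightarrow> u \<cdot> f = g"
proof -
  let ?v = "inverse_arrow C u"
  have v: "?v \<in> hom C c b" "?v \<cdot> u = Ide C b" "u \<cdot> ?v = Ide C c"
    using inverse_arrows_inverse_arrow[OF u(1)] homD[OF u(2)] by (auto simp: inverse_arrows_def)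
  show ?thesis
    using Comp_assoc[OF f u(2) v(1)] Comp_assoc[OF g v(1) u(2)] v(2,3)
      Comp_Ide_left[OF f] Comp_Ide_left[OF g] by auto
qed

text \<open>Naturality of a family of isomorphisms, transported to the family of inverses.\<close>

lemma Comp_inverse_arrow_natural:
  assumes u: "iso_arrow C u" "u \<in> hom C b c" and u': "iso_arrow C u'" "u' \<in> hom C b' c'"
    and f: "f \<in> hom C b b'" and g: "g \<in> hom C c c'" and nat: "u' \<cdot> f = g \<cdot> u"
  shows "f \<cdot> inverse_arrow C u = inverse_arrow C u' \<cdot> g"
proof -
  let ?v = "inverse_arrow C u"
  have v: "?v \<in> hom C c b" "u \<cdot> ?v = Ide C c"
    using inverse_arrows_inverse_arrow[OF u(1)] homD[OF u(2)] by (auto simp: inverse_arrows_def)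
  have "u' \<cdot> (f \<cdot> ?v) = (u' \<cdot> f) \<cdot> ?v"
    using Comp_assoc[OF v(1) f u'(2)] by simp
  also have "\<dots> = g"
    using Comp_assoc[OF v(1) u(2) g] v(2) nat Comp_Ide_right[OF g] by simp
  finally show ?thesis
    using eq_inverse_arrow_Comp_iff[OF u' Comp_hom[OF v(1) f] g] by simp
qed

lemma arr_pow_simps:
  assumes "f \<in> hom C a a"
  shows "arr_pow C a f 0 = Ide C a" "arr_pow C a f (Suc 0) = f"
  using Comp_Ide_right[OF assms] by (simp_all add: arr_pow_def)

text \<open>Horizontal pasting of two commuting squares with vertical sides \<open>x\<close>, \<open>y\<close> and \<open>z\<close>.\<close>

lemma commuting_squares_Comp:
  assumes "f \<in> hom C a b" "g \<in> hom C b c" "f' \<in> hom C a' b'" "g' \<in> hom C b' c'"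
    and "x \<in> hom C a a'" "y \<in> hom C b b'" "z \<in> hom C c c'"
    and "y \<cdot> f = f' \<cdot> x" and "z \<cdot> g = g' \<cdot> y"
  shows "z \<cdot> (g \<cdot> f) = (g' \<cdot> f') \<cdot> x"
proof -
  have "z \<cdot> (g \<cdot> f) = (g' \<cdot> y) \<cdot> f"
    using assms Comp_assoc[of f a b g c z c'] by simp
  also have "\<dots> = g' \<cdot> (f' \<cdot> x)"
    using assms Comp_assoc[of f a b y b' g' c'] by simp
  also have "\<dots> = (g' \<cdot> f') \<cdot> x"
    using assms Comp_assoc[of x a a' f' b' g' c'] by simp
  finally show ?thesis .
qed

end

context monoidal_category
begin

lemma category_L_monoidal: "category (L_monoidal V)"
proof -
  have "category (L_cat V)"
    unfolding L_cat_def
    by (rule category_structured_cat)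
      (auto simp: Comp_Ide_left Comp_Ide_right
        intro: category_axioms commuting_squares_Comp commuting_squares_Comp[symmetric])
  then show ?thesis
    by (simp add: category_def hom_def L_monoidal_def)
qed

lemma Ide_Comp_Ide: "a \<in> Obj V \<Longrightarrow> Ide V a \<cdot> Ide V a = Ide V a"
  using Comp_Ide_left Ide_hom by blast

lemma UnitO_endo: "(UnitO V, Ide V (UnitO V), Ide V (UnitO V)) \<in> Obj (L_cat V)"
  by (simp add: Obj_L_cat Ide_hom UnitO_Obj)

lemma L_prodO_pair_Obj:
  assumes "X \<in> Obj (L_cat V)" "Y \<in> Obj (L_cat V)"
  shows "L_prodO V [X, Y] \<in> Obj (L_cat V)"
  using assms
  by (cases X; cases Y) (auto simp: L_prodO_def Obj_L_cat TenO_Obj TenA_hom simp flip: TenA_Comp)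


section \<open>The coherence transformations in low arities\<close>

context
  fixes a \<alpha> \<beta>
  assumes X: "(a, \<alpha>, \<beta>) \<in> Obj (L_cat V)"
begin

lemma Obj_L_catD: "a \<in> Obj V" "\<alpha> \<in> hom V a a" "\<beta> \<in> hom V a a"
  using X by (simp_all add: Obj_L_cat)

text \<open>
  The associator is the \<open>flatten\<close> of rows of lengths \<open>2\<close> and \<open>1\<close>.  For rows of lengths \<open>1\<close> and \<open>2\<close>,
  as in \<open>L_Phi_one_two\<close>, \<open>flatten\<close> is an identity, since iterated products are bracketed to
  the right.
\<close>

lemma L_Phi_two_one:
  "L_Phi V [[(a, \<alpha>, \<beta>), (a, \<alpha>, \<beta>)], [(a, \<alpha>, \<beta>)]] =
    (L_prodO V [L_prodO V [(a, \<alpha>, \<beta>), (a, \<alpha>, \<beta>)], (a, \<alpha>, \<beta>)],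
     Assoc V a a a \<cdot> ((Ide V a \<otimes>\<^sub>a Ide V a) \<otimes>\<^sub>a \<beta>),
     L_prodO V [(a, \<alpha>, \<beta>), (a, \<alpha>, \<beta>), (a, \<alpha>, \<beta>)])"
  using Obj_L_catD Assoc_hom[OF Obj_L_catD(1) Obj_L_catD(1) Obj_L_catD(1)]
  by (simp add: L_Phi_def L_plug_def L_endo_def L_prodO_def bar_def Z_def arr_pow_simps
      Ide_Comp_Ide TenA_Ide TenO_Obj Comp_Ide_left Comp_Ide_right)

lemma L_Phi_one_two:
  "L_Phi V [[(a, \<alpha>, \<beta>)], [(a, \<alpha>, \<beta>), (a, \<alpha>, \<beta>)]] =
    (L_prodO V [(a, \<alpha>, \<beta>), L_prodO V [(a, \<alpha>, \<beta>), (a, \<alpha>, \<beta>)]],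
     \<alpha> \<otimes>\<^sub>a (Ide V a \<otimes>\<^sub>a Ide V a),
     L_prodO V [(a, \<alpha>, \<beta>), (a, \<alpha>, \<beta>), (a, \<alpha>, \<beta>)])"
  using Obj_L_catD TenA_hom[OF Obj_L_catD(2) Ide_hom[OF TenO_Obj[OF Obj_L_catD(1) Obj_L_catD(1)]]]
  by (simp add: L_Phi_def L_plug_def L_endo_def L_prodO_def bar_def Z_def arr_pow_simps
      Ide_Comp_Ide TenA_Ide TenO_Obj Comp_Ide_left Comp_Ide_right)

text \<open>
  By definition \<open>\<phi>\<close> applies the inverse unitor before the endomorphism of \<open>I \<otimes> a\<close> or \<open>a \<otimes> I\<close>;
  naturality of the unitor moves the endomorphism to \<open>a\<close>.
\<close>

lemma L_phi_zero_one:
  "L_phi V [[], [(a, \<alpha>, \<beta>)]] =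
    ((a, \<alpha>, \<beta>), inverse_arrow V (LUnit V a) \<cdot> \<beta>, L_prodO V [L_prodO V [], (a, \<alpha>, \<beta>)])"
proof -
  note \<beta>' = TenA_hom[OF Ide_hom[OF UnitO_Obj] Obj_L_catD(3)]
  note inv = inverse_arrow_hom[OF LUnit_iso LUnit_hom, OF Obj_L_catD(1) Obj_L_catD(1)]
  have "(Ide V (UnitO V) \<otimes>\<^sub>a \<beta>) \<cdot> inverse_arrow V (LUnit V a) = inverse_arrow V (LUnit V a) \<cdot> \<beta>"
    by (rule Comp_inverse_arrow_natural[OF LUnit_iso LUnit_hom LUnit_iso LUnit_hom])
      (use Obj_L_catD \<beta>' LUnit_natural in auto)
  then show ?thesis
    using Obj_L_catD LUnit_hom[OF Obj_L_catD(1)] Comp_hom[OF inv \<beta>']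
    by (simp add: L_phi_def L_plug_def L_endo_def L_prodO_def Z_def arr_pow_simps
        Ide_Comp_Ide TenA_Ide TenO_Obj UnitO_Obj Comp_Ide_left Comp_Ide_right)
qed

lemma L_phi_one_zero:
  "L_phi V [[(a, \<alpha>, \<beta>)], []] =
    ((a, \<alpha>, \<beta>), inverse_arrow V (RUnit V a) \<cdot> \<alpha>, L_prodO V [(a, \<alpha>, \<beta>), L_prodO V []])"
proof -
  note \<alpha>' = TenA_hom[OF Obj_L_catD(2) Ide_hom[OF UnitO_Obj]]
  note inv = inverse_arrow_hom[OF RUnit_iso RUnit_hom, OF Obj_L_catD(1) Obj_L_catD(1)]
  have "(\<alpha> \<otimes>\<^sub>a Ide V (UnitO V)) \<cdot> inverse_arrow V (RUnit V a) = inverse_arrow V (RUnit V a) \<cdot> \<alpha>"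
    by (rule Comp_inverse_arrow_natural[OF RUnit_iso RUnit_hom RUnit_iso RUnit_hom])
      (use Obj_L_catD \<alpha>' RUnit_natural in auto)
  then show ?thesis
    using Obj_L_catD RUnit_hom[OF Obj_L_catD(1)] Comp_hom[OF inv \<alpha>']
    by (simp add: L_phi_def L_plug_def L_endo_def L_prodO_def Z_def arr_pow_simps
        Ide_Comp_Ide TenA_Ide TenO_Obj UnitO_Obj Comp_Ide_left Comp_Ide_right)
qed

end


section \<open>Cosemigroups and comonoids of objects with two commuting endomorphisms\<close>

text \<open>
  The arrow \<open>d\<close> of \<open>L\<close> carries its source and target, so it is determined by its underlying
  arrow \<open>\<delta>\<close> of \<open>V\<close>.
\<close>

lemma is_cosemigroup_L_monoidal_iff:
  "is_cosemigroup (L_monoidal V) ((a, \<alpha>, \<beta>), d) \<longleftrightarrow>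
    (\<exists>\<delta>. d = ((a, \<alpha>, \<beta>), \<delta>, L_prodO V [(a, \<alpha>, \<beta>), (a, \<alpha>, \<beta>)]) \<and>
      is_bihom_comonoid V (a, \<alpha>, \<beta>, \<delta>))"
proof (cases "(a, \<alpha>, \<beta>) \<in> Obj (L_cat V)")
  case False
  then show ?thesis
    by (auto simp: is_cosemigroup_def is_bihom_comonoid_def Obj_L_cat)
next
  case True
  let ?X = "(a, \<alpha>, \<beta>)"
  have prod: "L_prodO V [?X, ?X] = (a \<otimes>\<^sub>o a, \<alpha> \<otimes>\<^sub>a \<alpha>, \<beta> \<otimes>\<^sub>a \<beta>)"
    by (simp add: L_prodO_def)
  have d: "d \<in> hom (L_monoidal V) ?X (L_prodO V [?X, ?X]) \<longleftrightarrow>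
    (\<exists>\<delta>. d = (?X, \<delta>, L_prodO V [?X, ?X]) \<and> \<delta> \<in> hom V a (a \<otimes>\<^sub>o a) \<and>
      \<delta> \<cdot> \<alpha> = (\<alpha> \<otimes>\<^sub>a \<alpha>) \<cdot> \<delta> \<and> \<delta> \<cdot> \<beta> = (\<beta> \<otimes>\<^sub>a \<beta>) \<cdot> \<delta>)"
    using True L_prodO_pair_Obj[OF True True]
    by (simp add: prod hom_L_monoidal hom_L_cat)
  have coassoc:
    "\<Phi>\<^bsub>L_monoidal V\<^esub> [[?X, ?X], [?X]] \<cdot>\<^bsub>L_monoidal V\<^esub>
       (ProdA (L_monoidal V) [(?X, \<delta>, L_prodO V [?X, ?X]), \<iota>\<^bsub>L_monoidal V\<^esub> ?X]
         \<cdot>\<^bsub>L_monoidal V\<^esub> (?X, \<delta>, L_prodO V [?X, ?X])) =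
     \<Phi>\<^bsub>L_monoidal V\<^esub> [[?X], [?X, ?X]] \<cdot>\<^bsub>L_monoidal V\<^esub>
       (ProdA (L_monoidal V) [\<iota>\<^bsub>L_monoidal V\<^esub> ?X, (?X, \<delta>, L_prodO V [?X, ?X])]
         \<cdot>\<^bsub>L_monoidal V\<^esub> (?X, \<delta>, L_prodO V [?X, ?X])) \<longleftrightarrow>
     Assoc V a a a \<cdot> (((Ide V a \<otimes>\<^sub>a Ide V a) \<otimes>\<^sub>a \<beta>) \<cdot> ((\<delta> \<otimes>\<^sub>a Ide V a) \<cdot> \<delta>)) =
     (\<alpha> \<otimes>\<^sub>a (Ide V a \<otimes>\<^sub>a Ide V a)) \<cdot> ((Ide V a \<otimes>\<^sub>a \<delta>) \<cdot> \<delta>)"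
    if \<delta>: "\<delta> \<in> hom V a (a \<otimes>\<^sub>o a)" for \<delta>
  proof -
    note a = Obj_L_catD[OF True]
    have "(Assoc V a a a \<cdot> ((Ide V a \<otimes>\<^sub>a Ide V a) \<otimes>\<^sub>a \<beta>)) \<cdot> ((\<delta> \<otimes>\<^sub>a Ide V a) \<cdot> \<delta>) =
      Assoc V a a a \<cdot> (((Ide V a \<otimes>\<^sub>a Ide V a) \<otimes>\<^sub>a \<beta>) \<cdot> ((\<delta> \<otimes>\<^sub>a Ide V a) \<cdot> \<delta>))"
      by (rule Comp_assoc[OF Comp_hom[OF \<delta> TenA_hom[OF \<delta> Ide_hom]]
            TenA_hom[OF TenA_hom[OF Ide_hom Ide_hom]] Assoc_hom]) (use a in auto)
    then show ?thesis
      by (simp add: L_Phi_two_one[OF True] L_Phi_one_two[OF True] L_prodA_def)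
  qed
  show ?thesis
    using True d coassoc
    unfolding is_cosemigroup_def is_bihom_comonoid_def by (auto simp: Obj_L_cat)
qed

lemma is_comonoid_L_monoidal_iff:
  "is_comonoid (L_monoidal V) ((a, \<alpha>, \<beta>), d, e) \<longleftrightarrow>
    (\<exists>\<delta> \<epsilon>. d = ((a, \<alpha>, \<beta>), \<delta>, L_prodO V [(a, \<alpha>, \<beta>), (a, \<alpha>, \<beta>)]) \<and>
      e = ((a, \<alpha>, \<beta>), \<epsilon>, L_prodO V []) \<and>
      is_counital_bihom_comonoid V (a, \<alpha>, \<beta>, \<delta>, \<epsilon>))"
proof (cases "(a, \<alpha>, \<beta>) \<in> Obj (L_cat V)")
  case False
  then show ?thesis
    by (auto simp: is_comonoid_def is_cosemigroup_def is_counital_bihom_comonoid_def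
        is_bihom_comonoid_def Obj_L_cat)
next
  case True
  let ?X = "(a, \<alpha>, \<beta>)"
  note a = Obj_L_catD[OF True]
  have unit: "L_prodO V [] = (UnitO V, Ide V (UnitO V), Ide V (UnitO V))"
    by (simp add: L_prodO_def)
  have e: "e \<in> hom (L_monoidal V) ?X (L_prodO V []) \<longleftrightarrow>
    (\<exists>\<epsilon>. e = (?X, \<epsilon>, L_prodO V []) \<and> \<epsilon> \<in> hom V a (UnitO V) \<and> \<epsilon> \<cdot> \<alpha> = \<epsilon> \<and> \<epsilon> \<cdot> \<beta> = \<epsilon>)"
    using True UnitO_endo
    by (auto simp: unit hom_L_monoidal hom_L_cat Comp_Ide_left)
  have counit:
    "ProdA (L_monoidal V) [(?X, \<epsilon>, L_prodO V []), Ide (L_monoidal V) ?X]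
       \<cdot>\<^bsub>L_monoidal V\<^esub> (?X, \<delta>, L_prodO V [?X, ?X]) =
     \<phi>\<^bsub>L_monoidal V\<^esub> [[], [?X]] \<cdot>\<^bsub>L_monoidal V\<^esub> \<iota>\<^bsub>L_monoidal V\<^esub> ?X \<longleftrightarrow>
     LUnit V a \<cdot> ((\<epsilon> \<otimes>\<^sub>a Ide V a) \<cdot> \<delta>) = \<beta>"
    "ProdA (L_monoidal V) [Ide (L_monoidal V) ?X, (?X, \<epsilon>, L_prodO V [])]
       \<cdot>\<^bsub>L_monoidal V\<^esub> (?X, \<delta>, L_prodO V [?X, ?X]) =
     \<phi>\<^bsub>L_monoidal V\<^esub> [[?X], []] \<cdot>\<^bsub>L_monoidal V\<^esub> \<iota>\<^bsub>L_monoidal V\<^esub> ?X \<longleftrightarrow>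
     RUnit V a \<cdot> ((Ide V a \<otimes>\<^sub>a \<epsilon>) \<cdot> \<delta>) = \<alpha>"
    if \<delta>: "\<delta> \<in> hom V a (a \<otimes>\<^sub>o a)" and \<epsilon>: "\<epsilon> \<in> hom V a (UnitO V)" for \<delta> \<epsilon>
  proof -
    note l = LUnit_iso[OF a(1)] LUnit_hom[OF a(1)] and r = RUnit_iso[OF a(1)] RUnit_hom[OF a(1)]
    have "(\<epsilon> \<otimes>\<^sub>a Ide V a) \<cdot> \<delta> = inverse_arrow V (LUnit V a) \<cdot> \<beta> \<longleftrightarrow>
        LUnit V a \<cdot> ((\<epsilon> \<otimes>\<^sub>a Ide V a) \<cdot> \<delta>) = \<beta>"
      by (rule eq_inverse_arrow_Comp_iff[OF l Comp_hom[OF \<delta> TenA_hom[OF \<epsilon> Ide_hom]]])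
        (use a in auto)
    moreover have "(Ide V a \<otimes>\<^sub>a \<epsilon>) \<cdot> \<delta> = inverse_arrow V (RUnit V a) \<cdot> \<alpha> \<longleftrightarrow>
        RUnit V a \<cdot> ((Ide V a \<otimes>\<^sub>a \<epsilon>) \<cdot> \<delta>) = \<alpha>"
      by (rule eq_inverse_arrow_Comp_iff[OF r Comp_hom[OF \<delta> TenA_hom[OF Ide_hom \<epsilon>]]])
        (use a in auto)
    moreover have "(inverse_arrow V (LUnit V a) \<cdot> \<beta>) \<cdot> Ide V a = inverse_arrow V (LUnit V a) \<cdot> \<beta>"
      "(inverse_arrow V (RUnit V a) \<cdot> \<alpha>) \<cdot> Ide V a = inverse_arrow V (RUnit V a) \<cdot> \<alpha>"
      using Comp_Ide_right[OF Comp_hom[OF a(3) inverse_arrow_hom[OF l]]]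
        Comp_Ide_right[OF Comp_hom[OF a(2) inverse_arrow_hom[OF r]]] by simp_all
    ultimately show
      "ProdA (L_monoidal V) [(?X, \<epsilon>, L_prodO V []), Ide (L_monoidal V) ?X]
         \<cdot>\<^bsub>L_monoidal V\<^esub> (?X, \<delta>, L_prodO V [?X, ?X]) =
       \<phi>\<^bsub>L_monoidal V\<^esub> [[], [?X]] \<cdot>\<^bsub>L_monoidal V\<^esub> \<iota>\<^bsub>L_monoidal V\<^esub> ?X \<longleftrightarrow>
       LUnit V a \<cdot> ((\<epsilon> \<otimes>\<^sub>a Ide V a) \<cdot> \<delta>) = \<beta>"
      "ProdA (L_monoidal V) [Ide (L_monoidal V) ?X, (?X, \<epsilon>, L_prodO V [])]
         \<cdot>\<^bsub>L_monoidal V\<^esub> (?X, \<delta>, L_prodO V [?X, ?X]) =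
       \<phi>\<^bsub>L_monoidal V\<^esub> [[?X], []] \<cdot>\<^bsub>L_monoidal V\<^esub> \<iota>\<^bsub>L_monoidal V\<^esub> ?X \<longleftrightarrow>
       RUnit V a \<cdot> ((Ide V a \<otimes>\<^sub>a \<epsilon>) \<cdot> \<delta>) = \<alpha>"
      by (simp_all add: L_phi_zero_one[OF True] L_phi_one_zero[OF True] L_prodA_def)
  qed
  have hom_\<delta>: "\<delta> \<in> hom V a (a \<otimes>\<^sub>o a)" if "is_bihom_comonoid V (a, \<alpha>, \<beta>, \<delta>)" for \<delta>
    using that by (simp add: is_bihom_comonoid_def)
  show ?thesis (is "?L \<longleftrightarrow> ?R")
  proof
    assume ?L
    then obtain \<delta> \<epsilon> where "d = (?X, \<delta>, L_prodO V [?X, ?X])" "is_bihom_comonoid V (a, \<alpha>, \<beta>, \<delta>)"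
      "e = (?X, \<epsilon>, L_prodO V [])" "\<epsilon> \<in> hom V a (UnitO V)" "\<epsilon> \<cdot> \<alpha> = \<epsilon>" "\<epsilon> \<cdot> \<beta> = \<epsilon>"
      using e by (auto simp: is_comonoid_def is_cosemigroup_L_monoidal_iff)
    with \<open>?L\<close> counit[OF hom_\<delta>] show ?R
      by (simp add: is_comonoid_def is_counital_bihom_comonoid_def del: L_monoidal_simps)
  next
    assume ?R
    then obtain \<delta> \<epsilon> where "d = (?X, \<delta>, L_prodO V [?X, ?X])" "e = (?X, \<epsilon>, L_prodO V [])"
      "is_counital_bihom_comonoid V (a, \<alpha>, \<beta>, \<delta>, \<epsilon>)"
      by blast
    with e counit[OF hom_\<delta>] show ?L
      by (simp add: is_comonoid_def is_counital_bihom_comonoid_def is_cosemigroup_L_monoidal_iff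
          del: L_monoidal_simps(2-) add: L_monoidal_simps(4))
  qed
qed

section \<open>The isomorphisms of categories\<close>

lemma commuting_comultiplications_Comp:
  assumes "f \<in> hom V a a'" "g \<in> hom V a' a''"
    and "\<delta> \<in> hom V a (a \<otimes>\<^sub>o a)" "\<delta>' \<in> hom V a' (a' \<otimes>\<^sub>o a')" "\<delta>'' \<in> hom V a'' (a'' \<otimes>\<^sub>o a'')"
    and "\<delta>' \<cdot> f = (f \<otimes>\<^sub>a f) \<cdot> \<delta>" "\<delta>'' \<cdot> g = (g \<otimes>\<^sub>a g) \<cdot> \<delta>'"
  shows "\<delta>'' \<cdot> (g \<cdot> f) = ((g \<cdot> f) \<otimes>\<^sub>a (g \<cdot> f)) \<cdot> \<delta>"
  using commuting_squares_Comp[OF assms(1,2) TenA_hom[OF assms(1,1)] TenA_hom[OF assms(2,2)]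
      assms(3-7)] TenA_Comp[OF assms(1,2,1,2)] by simp

lemma category_bihom_comonoid_cat: "category (bihom_comonoid_cat V)"
  unfolding bihom_comonoid_cat_def
proof (rule category_structured_cat[OF category_axioms], goal_cases)
  case (1 X)
  then show ?case by (auto simp: is_bihom_comonoid_def)
next
  case (2 X)
  then show ?case
    by (auto simp: is_bihom_comonoid_def Comp_Ide_left Comp_Ide_right TenA_Ide)
next
  case (3 X Y Y' f g)
  then show ?case
    by (auto simp: is_bihom_comonoid_def
        intro: commuting_squares_Comp[symmetric] commuting_comultiplications_Comp)
qed

lemma category_counital_bihom_comonoid_cat: "category (counital_bihom_comonoid_cat V)"
  unfolding counital_bihom_comonoid_cat_def
proof (rule category_structured_cat[OF category_axioms], goal_cases)
  case (1 X)
  then show ?case by (auto simp: is_counital_bihom_comonoid_def is_bihom_comonoid_def)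
next
  case (2 X)
  then show ?case
    by (auto simp: is_counital_bihom_comonoid_def is_bihom_comonoid_def Comp_Ide_left Comp_Ide_right
        TenA_Ide)
next
  case (3 X Y Y' f g)
  have "\<epsilon>'' \<cdot> (g \<cdot> f) = \<epsilon>"
    if "\<epsilon>'' \<in> hom V (fst Y') (UnitO V)" "\<epsilon>'' \<cdot> g = \<epsilon>'" "\<epsilon>' \<cdot> f = \<epsilon>" for \<epsilon> \<epsilon>' \<epsilon>''
    using Comp_assoc[OF 3(4,5) that(1)] that by simp
  with 3 show ?case
    by (auto simp: is_counital_bihom_comonoid_def is_bihom_comonoid_def
        intro: commuting_squares_Comp[symmetric] commuting_comultiplications_Comp)
qed

lemma cosemigroups_isomorphic_bihom_comonoids:
  "isomorphic_categories (cosemigroup_cat (L_monoidal V)) (bihom_comonoid_cat V)"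
  unfolding cosemigroup_cat_def bihom_comonoid_cat_def
proof (rule isomorphic_structured_cats[where A = "\<lambda>(X, \<theta>, Y). \<theta>"
      and F = "\<lambda>((a, \<alpha>, \<beta>), (_, \<delta>, _)). (a, \<alpha>, \<beta>, \<delta>)"], goal_cases)
  case 1
  show ?case by (rule category_L_monoidal)
next
  case 2
  show ?case using category_bihom_comonoid_cat by (simp add: bihom_comonoid_cat_def)
next
  case (3 X)
  then show ?case by (auto simp: is_cosemigroup_def)
next
  case 4
  show ?case
    by (rule bij_betw_byWitness[where f' = "\<lambda>(a, \<alpha>, \<beta>, \<delta>).
          ((a, \<alpha>, \<beta>), ((a, \<alpha>, \<beta>), \<delta>, L_prodO V [(a, \<alpha>, \<beta>), (a, \<alpha>, \<beta>)]))"])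
      (auto simp: is_cosemigroup_L_monoidal_iff)
next
  case (5 X)
  then show ?case by (auto split: prod.splits)
next
  case (6 X Y Y' f g)
  show ?case by (cases f; cases g) simp
next
  case (7 X Y f)
  obtain a \<alpha> \<beta> d a' \<alpha>' \<beta>' d'
    where "X = ((a, \<alpha>, \<beta>), d)" "Y = ((a', \<alpha>', \<beta>'), d')"
    by (metis prod.exhaust)
  with 7 show ?case by (auto simp: is_cosemigroup_L_monoidal_iff hom_L_monoidal hom_L_cat)
next
  case (8 X Y f)
  obtain a \<alpha> \<beta> d a' \<alpha>' \<beta>' d'
    where "X = ((a, \<alpha>, \<beta>), d)" "Y = ((a', \<alpha>', \<beta>'), d')"
    by (metis prod.exhaust)
  with 8 show ?case
    by (auto simp: is_cosemigroup_L_monoidal_iff hom_L_monoidal hom_L_cat L_prodA_def)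
next
  case (9 X Y)
  obtain a \<alpha> \<beta> d a' \<alpha>' \<beta>' d'
    where "X = ((a, \<alpha>, \<beta>), d)" "Y = ((a', \<alpha>', \<beta>'), d')"
    by (metis prod.exhaust)
  with 9 show ?case
    by (auto simp: inj_on_def hom_L_monoidal hom_L_cat)
next
  case (10 X Y g)
  obtain a \<alpha> \<beta> d a' \<alpha>' \<beta>' d'
    where "X = ((a, \<alpha>, \<beta>), d)" "Y = ((a', \<alpha>', \<beta>'), d')"
    by (metis prod.exhaust)
  note XY = this
  have "((a, \<alpha>, \<beta>), g, (a', \<alpha>', \<beta>')) \<in> hom (L_monoidal V) (fst X) (fst Y)"
    using 10 by (auto simp: XY is_cosemigroup_L_monoidal_iff
        is_bihom_comonoid_def hom_L_monoidal hom_L_cat Obj_L_cat)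
  then show ?case
    by (rule rev_image_eqI) simp
qed

lemma comonoids_isomorphic_counital_bihom_comonoids:
  "isomorphic_categories (comonoid_cat (L_monoidal V)) (counital_bihom_comonoid_cat V)"
  unfolding comonoid_cat_def counital_bihom_comonoid_cat_def
proof (rule isomorphic_structured_cats[where A = "\<lambda>(X, \<theta>, Y). \<theta>"
      and F = "\<lambda>((a, \<alpha>, \<beta>), (_, \<delta>, _), (_, \<epsilon>, _)). (a, \<alpha>, \<beta>, \<delta>, \<epsilon>)"], goal_cases)
  case 1
  show ?case by (rule category_L_monoidal)
next
  case 2
  show ?case
    using category_counital_bihom_comonoid_cat by (simp add: counital_bihom_comonoid_cat_def)
next
  case (3 X)
  then show ?case by (auto simp: is_comonoid_def is_cosemigroup_def)
next
  case 4
  show ?case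
    by (rule bij_betw_byWitness[where f' = "\<lambda>(a, \<alpha>, \<beta>, \<delta>, \<epsilon>).
          ((a, \<alpha>, \<beta>), ((a, \<alpha>, \<beta>), \<delta>, L_prodO V [(a, \<alpha>, \<beta>), (a, \<alpha>, \<beta>)]),
           ((a, \<alpha>, \<beta>), \<epsilon>, L_prodO V []))"])
      (auto simp: is_comonoid_L_monoidal_iff)
next
  case (5 X)
  then show ?case by (auto split: prod.splits)
next
  case (6 X Y Y' f g)
  show ?case by (cases f; cases g) simp
next
  case (7 X Y f)
  obtain a \<alpha> \<beta> d e a' \<alpha>' \<beta>' d' e'
    where "X = ((a, \<alpha>, \<beta>), d, e)" "Y = ((a', \<alpha>', \<beta>'), d', e')"
    by (metis prod.exhaust)
  with 7 show ?case by (auto simp: is_comonoid_L_monoidal_iff hom_L_monoidal hom_L_cat)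
next
  case (8 X Y f)
  obtain a \<alpha> \<beta> d e a' \<alpha>' \<beta>' d' e'
    where "X = ((a, \<alpha>, \<beta>), d, e)" "Y = ((a', \<alpha>', \<beta>'), d', e')"
    by (metis prod.exhaust)
  with 8 show ?case
    by (auto simp: is_comonoid_L_monoidal_iff hom_L_monoidal hom_L_cat L_prodA_def)
next
  case (9 X Y)
  obtain a \<alpha> \<beta> d e a' \<alpha>' \<beta>' d' e'
    where "X = ((a, \<alpha>, \<beta>), d, e)" "Y = ((a', \<alpha>', \<beta>'), d', e')"
    by (metis prod.exhaust)
  with 9 show ?case
    by (auto simp: inj_on_def hom_L_monoidal hom_L_cat)
next
  case (10 X Y g)
  obtain a \<alpha> \<beta> d e a' \<alpha>' \<beta>' d' e'
    where "X = ((a, \<alpha>, \<beta>), d, e)" "Y = ((a', \<alpha>', \<beta>'), d', e')"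
    by (metis prod.exhaust)
  note XY = this
  have "((a, \<alpha>, \<beta>), g, (a', \<alpha>', \<beta>')) \<in> hom (L_monoidal V) (fst X) (fst Y)"
    using 10 by (auto simp: XY is_comonoid_L_monoidal_iff is_counital_bihom_comonoid_def
        is_bihom_comonoid_def hom_L_monoidal hom_L_cat Obj_L_cat)
  then show ?case
    by (rule rev_image_eqI) simp
qed

end

theorem theorem5p12:
  fixes V :: "('o, 'm) mon"
  assumes "monoidal_category V"
  shows "isomorphic_categories (cosemigroup_cat (L_monoidal V)) (bihom_comonoid_cat V) \<and>
         isomorphic_categories (comonoid_cat (L_monoidal V)) (counital_bihom_comonoid_cat V)"
proof -
  interpret monoidal_category V by fact
  show ?thesis
    using cosemigroups_isomorphic_bihom_comonoids comonoids_isomorphic_counital_bihom_comonoids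
    by blast
qed

end
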